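(* Let $\mathscr{S}$ be a basis of shapes in a domain $\Omega\subset\mathbb{R}^n$ of infinite measure. Assume that $\mathscr{S}$ satisfies the density condition, and that there is a constant $c$ such that for every rearrangeable $g\in\mathrm{BMO}_{\mathscr{S}}(\Omega)$ one has $g^*\in\mathrm{BMO}(\mathbb{R}_+)$ with $\|g^*\|_{\mathrm{BMO}}\le c\,\|g\|_{\mathrm{BMO}_{\mathscr{S}}}$. Let $f_k$, $k\in\mathbb{N}$, and $f$ be rearrangeable functions in $\mathrm{BMO}_{\mathscr{S}}(\Omega)$, and write $L:=\inf_{s>0} f^*(s)$. If $f\in\mathrm{VMO}_{\mathscr{S}}(\Omega)$, $f_k\to f$ in $\mathrm{BMO}_{\mathscr{S}}(\Omega)$, $0\le f_k\uparrow f$ pointwise (i.e. the $f_k$ are nonnegative and increase pointwise to $f$), and $(L-f_k^* )_+\to0$ in $\mathrm{BMO}(\mathbb{R}_+)$, then $f_k^*\to f^*$ in $\mathrm{BMO}(\mathbb{R}_+)$.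
   Context: $|\cdot|$ is Lebesgue measure, $y_+=\max(y,0)$, $\mathbb{R}_+=(0,\infty)$. A basis of shapes in a domain $\Omega\subset\mathbb{R}^n$ is a collection $\mathscr{S}$ of open sets $S\subset\Omega$ with $0<|S|<\infty$ that covers $\Omega$. For $f\in L^1(S)$ real-valued, $f_S=\frac1{|S|}\int_S f$ and $\mathcal{O}(f,S)=\frac1{|S|}\int_S|f-f_S|$. $\mathrm{BMO}_{\mathscr{S}}(\Omega)$ is the set of real-valued $f$ with $f\in L^1(S)$ for all $S\in\mathscr{S}$ and $\|f\|_{\mathrm{BMO}_{\mathscr{S}}}:=\sup_{S\in\mathscr{S}}\mathcal{O}(f,S)<\infty$ (a seminorm; functions are not identified modulo constants). $\mathrm{VMO}_{\mathscr{S}}(\Omega)$ is the set of $f\in\mathrm{BMO}_{\mathscr{S}}(\Omega)$ with $\lim_{\delta\to0^+}\sup_{S\in\mathscr{S},\,|S|\le\delta}\mathcal{O}(f,S)=0$. Convergence in a BMO space means convergence in its seminorm. $\mathrm{BMO}(\mathbb{R}_+)$ is the BMO space for the basis of all finite open intervals contained in $\mathbb{R}_+$ (including intervals $(0,b)$). Density condition on $\mathscr{S}$: there exists $q\in(0,\frac14]$ such that for every measurable $E\subset\Omega$ with $|E|>0$ and $|\Omega\setminus E|>0$, $$\limsup_{S\in\mathscr{S},\,|S|\to0}\rho(E,S)(1-\rho(E,S))\ge q,\qquad \rho(E,S)=\frac{|E\cap S|}{|S|}$$ (in particular, shapes of arbitrarily small measure exist). For measurable $f$ on $\Omega$, $\mu_f(\alpha)=|\{x\in\Omega:|f(x)|>\alpha\}|$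 for $\alpha\ge0$; $f$ is rearrangeable if $\mu_f(\alpha)\to0$ as $\alpha\to\infty$; and the decreasing rearrangement is $f^*(s)=|\{\alpha\ge0:\mu_f(\alpha)>s\}|$ for $s>0$. *)

theory Defs
  imports "HOL-Analysis.Analysis"
begin

text \<open>
  Functions on a domain \<open>\<Omega>\<close> are represented by total functions on the ambient Euclidean space;
  no definition below depends on their values outside \<open>\<Omega>\<close> (respectively outside the shapes).
\<close>

definition domain :: "'a::euclidean_space set \<Rightarrow> bool" where
  "domain \<Omega> \<longleftrightarrow> open \<Omega> \<and> connected \<Omega> \<and> \<Omega> \<noteq> {}"

definition basis_of_shapes :: "'a::euclidean_space set \<Rightarrow> 'a set set \<Rightarrow> bool" where
  "basis_of_shapes \<Omega> \<S> \<longleftrightarrow>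
     (\<forall>S\<in>\<S>. open S \<and> S \<subseteq> \<Omega> \<and> 0 < emeasure lebesgue S \<and> emeasure lebesgue S < \<infinity>) \<and>
     \<Omega> \<subseteq> \<Union>\<S>"

definition mean :: "('a::euclidean_space \<Rightarrow> real) \<Rightarrow> 'a set \<Rightarrow> real" where
  "mean f S = (1 / measure lebesgue S) * (LINT x:S|lebesgue. f x)"

definition mean_osc :: "('a::euclidean_space \<Rightarrow> real) \<Rightarrow> 'a set \<Rightarrow> real" where
  "mean_osc f S = (1 / measure lebesgue S) * (LINT x:S|lebesgue. \<bar>f x - mean f S\<bar>)"

text \<open>
  Suprema of oscillations are taken in \<^typ>\<open>ennreal\<close>, so that they are meaningful also when they
  are infinite or range over no shape at all (where they are 0).
\<close>

definition bmo_seminorm :: "'a::euclidean_space set set \<Rightarrow> ('a \<Rightarrow> real) \<Rightarrow> ennreal" where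
  "bmo_seminorm \<S> f = (SUP S\<in>\<S>. ennreal (mean_osc f S))"

definition BMO :: "'a::euclidean_space set set \<Rightarrow> ('a \<Rightarrow> real) set" where
  "BMO \<S> = {f. (\<forall>S\<in>\<S>. set_integrable lebesgue S f) \<and> bmo_seminorm \<S> f < \<infinity>}"

definition VMO :: "'a::euclidean_space set set \<Rightarrow> ('a \<Rightarrow> real) set" where
  "VMO \<S> = {f \<in> BMO \<S>.
     ((\<lambda>\<delta>::real. SUP S\<in>{S\<in>\<S>. measure lebesgue S \<le> \<delta>}. ennreal (mean_osc f S)) \<longlongrightarrow> 0)
       (at_right 0)}"

definition converges_in_BMO ::
    "'a::euclidean_space set set \<Rightarrow> (nat \<Rightarrow> 'a \<Rightarrow> real) \<Rightarrow> ('a \<Rightarrow> real) \<Rightarrow> bool" where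
  "converges_in_BMO \<S> F f \<longleftrightarrow>
     (\<forall>k. F k \<in> BMO \<S>) \<and> f \<in> BMO \<S> \<and>
     (\<lambda>k. bmo_seminorm \<S> (\<lambda>x. F k x - f x)) \<longlonglongrightarrow> 0"

text \<open>The basis of finite open intervals contained in \<open>(0, \<infinity>)\<close>.\<close>

definition pos_intervals :: "real set set" where
  "pos_intervals = {{a<..<b} |a b. 0 \<le> a \<and> a < b}"

text \<open>
  The filter \<open>S \<in> \<S>, |S| \<rightarrow> 0\<close>. It is trivial if \<open>\<S>\<close> has no shapes of arbitrarily small measure, and
  then the upper limit in the density condition is \<open>-\<infinity>\<close>, so that the condition fails.
\<close>

definition shrinking :: "'a::euclidean_space set set \<Rightarrow> 'a set filter" where
  "shrinking \<S> = inf (filtercomap (measure lebesgue) (at_right 0)) (principal \<S>)"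

definition shape_density :: "'a::euclidean_space set \<Rightarrow> 'a set \<Rightarrow> real" where
  "shape_density E S = measure lebesgue (E \<inter> S) / measure lebesgue S"

definition density_condition :: "'a::euclidean_space set \<Rightarrow> 'a set set \<Rightarrow> bool" where
  "density_condition \<Omega> \<S> \<longleftrightarrow>
     (\<exists>q::real. 0 < q \<and> q \<le> 1/4 \<and>
       (\<forall>E. E \<in> sets lebesgue \<and> E \<subseteq> \<Omega> \<and> 0 < emeasure lebesgue E \<and> 0 < emeasure lebesgue (\<Omega> - E) \<longrightarrow>
          Limsup (shrinking \<S>) (\<lambda>S. ereal (shape_density E S * (1 - shape_density E S))) \<ge> ereal q))"

definition distr_fun :: "'a::euclidean_space set \<Rightarrow> ('a \<Rightarrow> real) \<Rightarrow> real \<Rightarrow> ennreal" where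
  "distr_fun \<Omega> f \<alpha> = emeasure lebesgue {x\<in>\<Omega>. \<bar>f x\<bar> > \<alpha>}"

definition rearrangeable :: "'a::euclidean_space set \<Rightarrow> ('a \<Rightarrow> real) \<Rightarrow> bool" where
  "rearrangeable \<Omega> f \<longleftrightarrow>
     f \<in> borel_measurable (lebesgue_on \<Omega>) \<and> (distr_fun \<Omega> f \<longlongrightarrow> 0) at_top"

text \<open>
  For rearrangeable \<open>f\<close> and \<open>s > 0\<close> the set below is a bounded interval, so its measure is finite
  and taking it as a real number loses nothing. Only arguments \<open>s > 0\<close> are meaningful.
\<close>

definition decr_rearr :: "'a::euclidean_space set \<Rightarrow> ('a \<Rightarrow> real) \<Rightarrow> real \<Rightarrow> real" where
  "decr_rearr \<Omega> f s = measure lebesgue {\<alpha>. 0 \<le> \<alpha> \<and> distr_fun \<Omega> f \<alpha> > ennreal s}"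

end

theory Submission
  imports Defs
begin

text \<open>
  Write \<open>g = f\<^sup>*\<close> and \<open>g\<^sub>k = f\<^sub>k\<^sup>*\<close>. For \<open>N \<ge> L\<close>, each \<open>g\<^sub>k\<close> is the sum of its clamping to \<open>[L, N]\<close> and the
  excess \<open>(g\<^sub>k - N)\<^sub>+\<close>, minus \<open>(L - g\<^sub>k)\<^sub>+\<close>; the last term tends to 0 by assumption. The excess is the
  rearrangement of \<open>(f\<^sub>k - N)\<^sub>+\<close>, whose seminorm is small for large \<open>N\<close> uniformly in large \<open>k\<close>: on
  small shapes because \<open>f\<close> has vanishing mean oscillation, on large ones because
  \<open>(f\<^sub>k - N)\<^sub>+ \<le> (f - N)\<^sub>+\<close> has small integral over \<open>\<Omega>\<close>. Finally, the density condition and vanishing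
  mean oscillation exclude gaps in the range of \<open>f\<close>, so that the monotone convergence of the clamped
  rearrangements is uniform, by an argument of Dini type.
\<close>

section \<open>Mean oscillation on a single set of finite positive measure\<close>

lemma set_integrable_const:
  fixes c :: real
  assumes "S \<in> lmeasurable"
  shows "set_integrable lebesgue S (\<lambda>x. c)"
  using assms unfolding set_integrable_def fmeasurable_def
  by (auto intro!: integrable_mult_left integrable_real_indicator)

lemma set_integral_const_lmeasurable:
  fixes c :: real
  assumes "S \<in> lmeasurable"
  shows "(LINT x:S|lebesgue. c) = measure lebesgue S * c"
  using assms unfolding set_lebesgue_integral_def by (simp add: lmeasurable_iff_integrable)

lemma set_integrable_max_real:
  fixes u v :: "'a \<Rightarrow> real"
  assumes "set_integrable M S u" "set_integrable M S v"
  shows "set_integrable M S (\<lambda>x. max (u x) (v x))"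
proof -
  have "(\<lambda>x. indicator S x *\<^sub>R max (u x) (v x)) = (\<lambda>x. max (indicator S x *\<^sub>R u x) (indicator S x *\<^sub>R v x))"
    by (auto simp: indicator_def)
  then show ?thesis
    using assms unfolding set_integrable_def by simp
qed

lemmas set_integrable_intros =
  set_integrable_const set_integrable_abs set_integral_diff(1) set_integral_add(1) set_integrable_max_real

text \<open>The mean differs from \<open>c\<close> by at most the average of
  \<open>\<bar>u x - c\<bar>\<close>, so replacing it by \<open>c\<close> costs a factor 2. Upper
  bounds for oscillations then reduce to a convenient choice of \<open>c\<close>.\<close>

lemma mean_osc_le_dist_const:
  assumes S: "S \<in> lmeasurable" "0 < measure lebesgue S" and u: "set_integrable lebesgue S u"
  shows "mean_osc u S \<le> 2 / measure lebesgue S * (LINT x:S|lebesgue. \<bar>u x - c\<bar>)"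
proof -
  let ?m = "mean u S" and ?V = "measure lebesgue S"
  let ?J = "LINT x:S|lebesgue. \<bar>u x - c\<bar>"
  have uc: "set_integrable lebesgue S (\<lambda>x. u x - c)"
    using S u by (intro set_integrable_intros)
  have "?V * (?m - c) = (LINT x:S|lebesgue. u x - c)"
    using S u by (simp add: mean_def set_integral_diff(2) set_integrable_const set_integral_const_lmeasurable algebra_simps)
  also have "\<bar>\<dots>\<bar> \<le> ?J"
    using uc unfolding set_lebesgue_integral_def set_integrable_def
    by (intro order.trans[OF integral_abs_bound] eq_refl Bochner_Integration.integral_cong)
      (auto simp: abs_mult)
  finally have m: "?V * \<bar>?m - c\<bar> \<le> ?J" using S by (simp add: abs_mult)
  have "(LINT x:S|lebesgue. \<bar>u x - ?m\<bar>) \<le> (LINT x:S|lebesgue. \<bar>u x - c\<bar> + \<bar>?m - c\<bar>)"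
    using S u by (intro set_integral_mono set_integrable_intros) auto
  also have "\<dots> = ?J + ?V * \<bar>?m - c\<bar>"
    using S uc by (simp add: set_integral_add(2) set_integrable_intros set_integral_const_lmeasurable)
  also have "\<dots> \<le> 2 * ?J" using m by simp
  finally show ?thesis using S by (simp add: mean_osc_def field_simps)
qed

text \<open>Formulas for rearrangements hold only at positive arguments, so functions have to be
  exchangeable when they agree on the set alone.\<close>

lemma mean_osc_cong:
  assumes "\<And>x. x \<in> S \<Longrightarrow> u x = v x"
  shows "mean_osc u S = mean_osc v S"
proof -
  have *: "indicator S x *\<^sub>R u x = indicator S x *\<^sub>R v x" for x
    using assms by (auto simp: indicator_def)
  have m: "mean u S = mean v S"
    unfolding mean_def set_lebesgue_integral_def * ..
  have **: "indicator S x *\<^sub>R \<bar>u x - k\<bar> = indicator S x *\<^sub>R \<bar>v x - k\<bar>" for x k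
    using assms by (auto simp: indicator_def)
  show ?thesis
    unfolding mean_osc_def set_lebesgue_integral_def m ** ..
qed

lemma bmo_seminorm_cong:
  assumes "\<And>S x. S \<in> \<S> \<Longrightarrow> x \<in> S \<Longrightarrow> u x = v x"
  shows "bmo_seminorm \<S> u = bmo_seminorm \<S> v"
  unfolding bmo_seminorm_def by (intro SUP_cong refl arg_cong[of _ _ ennreal] mean_osc_cong assms)

lemma mean_osc_le_bmo_seminorm:
  assumes "S \<in> \<S>" "bmo_seminorm \<S> u \<le> ennreal e" "0 \<le> e"
  shows "mean_osc u S \<le> e"
proof -
  have "ennreal (mean_osc u S) \<le> bmo_seminorm \<S> u"
    unfolding bmo_seminorm_def by (rule SUP_upper[OF assms(1)])
  then show ?thesis using assms(2,3) by (metis ennreal_le_iff order.trans)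
qed

lemma mean_osc_diff_le:
  assumes S: "S \<in> lmeasurable"
    and u: "set_integrable lebesgue S u" and v: "set_integrable lebesgue S v"
  shows "mean_osc (\<lambda>x. u x - v x) S \<le> mean_osc u S + mean_osc v S"
proof -
  have m: "mean (\<lambda>x. u x - v x) S = mean u S - mean v S"
    using u v by (simp add: mean_def set_integral_diff(2) right_diff_distrib)
  have "(LINT x:S|lebesgue. \<bar>u x - v x - (mean u S - mean v S)\<bar>)
      \<le> (LINT x:S|lebesgue. \<bar>u x - mean u S\<bar> + \<bar>v x - mean v S\<bar>)"
    using S u v by (intro set_integral_mono set_integrable_intros) auto
  also have "\<dots> = (LINT x:S|lebesgue. \<bar>u x - mean u S\<bar>) + (LINT x:S|lebesgue. \<bar>v x - mean v S\<bar>)"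
    using S u v by (intro set_integral_add(2) set_integrable_intros)
  finally have "(LINT x:S|lebesgue. \<bar>u x - v x - (mean u S - mean v S)\<bar>)
      \<le> (LINT x:S|lebesgue. \<bar>u x - mean u S\<bar>) + (LINT x:S|lebesgue. \<bar>v x - mean v S\<bar>)" .
  from mult_left_mono[OF this, of "1 / measure lebesgue S"] show ?thesis
    by (simp add: mean_osc_def m distrib_left)
qed

text \<open>Truncation is 1-Lipschitz: comparing with the truncated mean of \<open>u\<close>, in
  place of the mean of the truncation, gives the factor 2.\<close>

lemma mean_osc_truncate_le:
  assumes S: "S \<in> lmeasurable" "0 < measure lebesgue S" and u: "set_integrable lebesgue S u"
  shows "mean_osc (\<lambda>x. max (u x - N) 0) S \<le> 2 * mean_osc u S"
proof -
  let ?m = "mean u S"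
  have "mean_osc (\<lambda>x. max (u x - N) 0) S
      \<le> 2 / measure lebesgue S * (LINT x:S|lebesgue. \<bar>max (u x - N) 0 - max (?m - N) 0\<bar>)"
    using S u by (intro mean_osc_le_dist_const set_integrable_intros)
  also have "\<dots> \<le> 2 / measure lebesgue S * (LINT x:S|lebesgue. \<bar>u x - ?m\<bar>)"
    using S u by (intro mult_left_mono set_integral_mono set_integrable_intros) auto
  finally show ?thesis by (simp add: mean_osc_def)
qed

lemma mean_osc_le_bound:
  assumes S: "S \<in> lmeasurable" "0 < measure lebesgue S" and u: "set_integrable lebesgue S u"
    and b: "\<And>x. x \<in> S \<Longrightarrow> \<bar>u x\<bar> \<le> b"
  shows "mean_osc u S \<le> 2 * b"
proof -
  have "mean_osc u S \<le> 2 / measure lebesgue S * (LINT x:S|lebesgue. \<bar>u x\<bar>)"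
    using mean_osc_le_dist_const[OF S u, of 0] by simp
  also have "\<dots> \<le> 2 / measure lebesgue S * (LINT x:S|lebesgue. b)"
    using S u b by (intro mult_left_mono set_integral_mono set_integrable_intros) auto
  also have "\<dots> = 2 * b" using S by (simp add: set_integral_const_lmeasurable)
  finally show ?thesis .
qed

text \<open>The mean lies on one side of the midpoint of \<open>t\<close> and \<open>t'\<close>,
  hence at distance at least half the gap from the values of \<open>u\<close> on the opposite part
  of \<open>S\<close>. That part has relative measure \<open>shape_density E S\<close> or its
  complement, and each dominates the product. The upper bound on the gap is only almost everywhere
  because \<open>E\<close> will be the superlevel set at \<open>t\<close>, which agrees with the one
  at \<open>t'\<close> up to a null set.\<close>

lemma mean_osc_ge_gap:
  assumes S: "S \<in> lmeasurable" "0 < measure lebesgue S" and u: "set_integrable lebesgue S u"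
    and E: "E \<in> sets lebesgue" and "t < t'"
    and above: "AE x in lebesgue. x \<in> E \<inter> S \<longrightarrow> t' \<le> u x"
    and below: "\<And>x. x \<in> S - E \<Longrightarrow> u x \<le> t"
  shows "(t' - t) / 2 * (shape_density E S * (1 - shape_density E S)) \<le> mean_osc u S"
proof -
  let ?m = "mean u S" and ?V = "measure lebesgue S" and ?d = "(t' - t) / 2"
  have ES: "E \<inter> S \<in> lmeasurable" "S - E \<in> lmeasurable"
    using S E fmeasurable_Int_fmeasurable[of S lebesgue E] by (auto intro: fmeasurable_Diff simp: Int_commute)
  have V: "measure lebesgue (S - E) = ?V - measure lebesgue (E \<inter> S)"
    using measurable_measure_Diff[of S lebesgue "E \<inter> S"] S ES
    by (simp add: fmeasurableD Diff_Int)
  have part: "?d * measure lebesgue A \<le> ?V * mean_osc u S"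
    if A: "A \<in> lmeasurable" "A \<subseteq> S" and ae: "AE x in lebesgue. x \<in> A \<longrightarrow> ?d \<le> \<bar>u x - ?m\<bar>" for A
  proof -
    have "?d * measure lebesgue A = (LINT x:A|lebesgue. ?d)"
      using A by (simp add: set_integral_const_lmeasurable algebra_simps)
    also have "\<dots> \<le> (LINT x:S|lebesgue. \<bar>u x - ?m\<bar>)"
      unfolding set_lebesgue_integral_def
    proof (rule integral_mono_AE)
      show "integrable lebesgue (\<lambda>x. indicator A x *\<^sub>R ?d)"
        using set_integrable_const[OF A(1)] unfolding set_integrable_def .
      show "integrable lebesgue (\<lambda>x. indicator S x *\<^sub>R \<bar>u x - ?m\<bar>)"
        using S u by (fold set_integrable_def) (intro set_integrable_intros)
      show "AE x in lebesgue. indicator A x *\<^sub>R ?d \<le> indicator S x *\<^sub>R \<bar>u x - ?m\<bar>"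
        using ae by eventually_elim (use A in \<open>auto simp: indicator_def\<close>)
    qed
    finally show ?thesis using S by (simp add: mean_osc_def)
  qed
  have \<rho>: "0 \<le> shape_density E S" "shape_density E S \<le> 1"
    using S ES V measure_nonneg[of lebesgue "S - E"] by (auto simp: shape_density_def)
  show ?thesis
  proof (cases "?m \<le> (t + t') / 2")
    case True
    have "?d * measure lebesgue (E \<inter> S) \<le> ?V * mean_osc u S"
    proof (rule part)
      show "AE x in lebesgue. x \<in> E \<inter> S \<longrightarrow> ?d \<le> \<bar>u x - ?m\<bar>"
        using above by eventually_elim (use True in \<open>auto simp: field_simps abs_if\<close>)
    qed (use ES in auto)
    then have "?d * shape_density E S \<le> mean_osc u S"
      using S by (simp add: shape_density_def field_simps)
    moreover have "?d * (shape_density E S * (1 - shape_density E S)) \<le> ?d * shape_density E S"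
      using \<rho> \<open>t < t'\<close> by (intro mult_left_mono mult_left_le) auto
    ultimately show ?thesis by linarith
  next
    case False
    have "?d * measure lebesgue (S - E) \<le> ?V * mean_osc u S"
    proof (intro part AE_I2 impI)
      fix x assume "x \<in> S - E"
      from below[OF this] show "?d \<le> \<bar>u x - ?m\<bar>" using False by (auto simp: field_simps abs_if)
    qed (use ES in auto)
    then have "?d * (1 - shape_density E S) \<le> mean_osc u S"
      using S by (simp add: V shape_density_def field_simps)
    moreover have "?d * (shape_density E S * (1 - shape_density E S)) \<le> ?d * (1 - shape_density E S)"
      using \<rho> \<open>t < t'\<close> by (intro mult_left_mono mult_left_le_one_le) auto
    ultimately show ?thesis by linarith
  qed
qed

section \<open>Distribution functions and decreasing rearrangements\<close>

lemma superlevel_sets_lebesgue: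
  fixes u :: "'a::euclidean_space \<Rightarrow> real"
  assumes "\<Omega> \<in> sets lebesgue" "u \<in> borel_measurable (lebesgue_on \<Omega>)"
  shows "{x\<in>\<Omega>. t < u x} \<in> sets lebesgue"
proof -
  have "{x \<in> space (lebesgue_on \<Omega>). t < u x} \<in> sets (lebesgue_on \<Omega>)"
    using assms(2) by measurable
  then show ?thesis
    using assms(1) by (auto simp: sets_restrict_space_iff)
qed

lemma abs_superlevel_sets_lebesgue:
  fixes u :: "'a::euclidean_space \<Rightarrow> real"
  assumes "\<Omega> \<in> sets lebesgue" "u \<in> borel_measurable (lebesgue_on \<Omega>)"
  shows "{x\<in>\<Omega>. t < \<bar>u x\<bar>} \<in> sets lebesgue"
  using assms by (intro superlevel_sets_lebesgue) auto

lemma distr_fun_antimono: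
  assumes "\<Omega> \<in> sets lebesgue" "u \<in> borel_measurable (lebesgue_on \<Omega>)" "a \<le> b"
  shows "distr_fun \<Omega> u b \<le> distr_fun \<Omega> u a"
  unfolding distr_fun_def using assms by (intro emeasure_mono abs_superlevel_sets_lebesgue) auto

text \<open>The superlevel set at \<open>a\<close> is the increasing union of those at
  \<open>a + 1 / real (Suc n)\<close>, so continuity of the measure from below applies. Together
  with monotonicity this amounts to right continuity of the distribution function.\<close>

lemma less_distr_fun_open:
  assumes "\<Omega> \<in> sets lebesgue" "u \<in> borel_measurable (lebesgue_on \<Omega>)" "y < distr_fun \<Omega> u a"
  shows "\<exists>b>a. y < distr_fun \<Omega> u b"
proof -
  let ?A = "\<lambda>n. {x\<in>\<Omega>. a + 1 / real (Suc n) < \<bar>u x\<bar>}"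
  have "incseq ?A"
  proof (intro incseq_SucI subsetI CollectI conjI; clarsimp)
    fix n x assume "a + 1 / (1 + real n) < \<bar>u x\<bar>"
    moreover have "1 / (2 + real n) \<le> 1 / (1 + real n)" by (simp add: field_simps)
    ultimately show "a + 1 / (2 + real n) < \<bar>u x\<bar>" by linarith
  qed
  moreover have "range ?A \<subseteq> sets lebesgue"
    using assms abs_superlevel_sets_lebesgue by blast
  moreover have "(\<Union>n. ?A n) = {x\<in>\<Omega>. a < \<bar>u x\<bar>}"
  proof (intro equalityI subsetI)
    fix x assume x: "x \<in> {x\<in>\<Omega>. a < \<bar>u x\<bar>}"
    then obtain n where "1 / real (Suc n) < \<bar>u x\<bar> - a"
      using nat_approx_posE[of "\<bar>u x\<bar> - a"] by auto
    with x show "x \<in> (\<Union>n. ?A n)" by (auto intro!: exI[of _ n])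
  next
    fix x assume "x \<in> (\<Union>n. ?A n)"
    then obtain n where n: "x \<in> ?A n" by blast
    have "0 < 1 / real (Suc n)" by simp
    with n have "a < \<bar>u x\<bar>" by (simp only: mem_Collect_eq) linarith
    with n show "x \<in> {x\<in>\<Omega>. a < \<bar>u x\<bar>}" by simp
  qed
  ultimately have "(\<lambda>n. emeasure lebesgue (?A n)) \<longlonglongrightarrow> distr_fun \<Omega> u a"
    using Lim_emeasure_incseq[of ?A lebesgue] by (simp add: distr_fun_def)
  then have "\<forall>\<^sub>F n in sequentially. y < emeasure lebesgue (?A n)"
    using assms(3) by (rule order_tendstoD)
  then obtain n where "y < distr_fun \<Omega> u (a + 1 / real (Suc n))"
    unfolding eventually_sequentially distr_fun_def by blast
  then show ?thesis by (intro exI[of _ "a + 1 / real (Suc n)"]) auto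
qed

lemma decr_rearr_nonneg: "0 \<le> decr_rearr \<Omega> u s"
  by (simp add: decr_rearr_def)

text \<open>The set measured by \<open>decr_rearr\<close> is a half-open interval starting at 0: it
  is downward closed, has no largest element, and is bounded because \<open>u\<close> is
  rearrangeable and \<open>s\<close> is positive. Through this equivalence all later statements
  about rearrangements become statements about distribution functions.\<close>

lemma less_decr_rearr_iff:
  assumes \<Omega>: "\<Omega> \<in> sets lebesgue" and u: "rearrangeable \<Omega> u" and "0 < s" "0 \<le> a"
  shows "a < decr_rearr \<Omega> u s \<longleftrightarrow> ennreal s < distr_fun \<Omega> u a"
proof -
  have um: "u \<in> borel_measurable (lebesgue_on \<Omega>)" using u by (simp add: rearrangeable_def)
  define A where "A = {a. 0 \<le> a \<and> ennreal s < distr_fun \<Omega> u a}"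
  \<comment> \<open>Inserting 0 makes the supremum equal to 0 when \<open>A\<close> is
    empty.\<close>
  define b where "b = Sup (insert 0 A)"
  have "\<forall>\<^sub>F a in at_top. distr_fun \<Omega> u a < ennreal s"
    using u \<open>0 < s\<close> unfolding rearrangeable_def by (auto intro: order_tendstoD)
  then obtain B where B: "\<forall>a\<ge>B. distr_fun \<Omega> u a < ennreal s"
    unfolding eventually_at_top_linorder by blast
  have "a \<le> max 0 B" if "a \<in> insert 0 A" for a
  proof (rule ccontr)
    assume "\<not> a \<le> max 0 B"
    with that have "a \<in> A" "B \<le> a" by auto
    with B show False unfolding A_def by (metis (mono_tags) mem_Collect_eq less_asym)
  qed
  then have bdd: "bdd_above (insert 0 A)" by (rule bdd_aboveI)
  have "A = {0..<b}"
  proof (intro equalityI subsetI)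
    fix x assume "x \<in> A"
    then obtain y where "y > x" "y \<in> A"
      using less_distr_fun_open[OF \<Omega> um] by (force simp: A_def)
    moreover have "y \<le> b" unfolding b_def using bdd \<open>y \<in> A\<close> by (intro cSup_upper) auto
    ultimately show "x \<in> {0..<b}" using \<open>x \<in> A\<close> by (auto simp: A_def)
  next
    fix x assume x: "x \<in> {0..<b}"
    then obtain y where "y \<in> insert 0 A" "x < y"
      using less_cSup_iff[OF _ bdd, of x] by (auto simp: b_def)
    with x have "y \<in> A" by auto
    with \<open>x < y\<close> x distr_fun_antimono[OF \<Omega> um, of x y] show "x \<in> A"
      by (auto simp: A_def intro: less_le_trans)
  qed
  moreover have "0 \<le> b" unfolding b_def using bdd by (intro cSup_upper) auto
  ultimately have "decr_rearr \<Omega> u s = b"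
    unfolding decr_rearr_def A_def by simp
  then show ?thesis
    using \<open>A = {0..<b}\<close> \<open>0 \<le> a\<close> unfolding A_def by (auto simp: set_eq_iff)
qed

lemma distr_fun_truncate:
  assumes "\<And>x. x \<in> \<Omega> \<Longrightarrow> 0 \<le> u x" "0 \<le> N" "0 \<le> a"
  shows "distr_fun \<Omega> (\<lambda>x. max (u x - N) 0) a = distr_fun \<Omega> u (N + a)"
  unfolding distr_fun_def using assms by (intro arg_cong[of _ _ "emeasure lebesgue"]) force

lemma rearrangeable_truncate:
  assumes u: "rearrangeable \<Omega> u" and nonneg: "\<And>x. x \<in> \<Omega> \<Longrightarrow> 0 \<le> u x" and N: "0 \<le> N"
  shows "rearrangeable \<Omega> (\<lambda>x. max (u x - N) 0)"
proof -
  have "filterlim (\<lambda>a. N + a) at_top at_top"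
    by (rule filterlim_tendsto_add_at_top[OF tendsto_const filterlim_ident])
  with u have "((\<lambda>a. distr_fun \<Omega> u (N + a)) \<longlongrightarrow> 0) at_top"
    by (auto simp: rearrangeable_def intro: filterlim_compose)
  moreover have "\<forall>\<^sub>F a in at_top. distr_fun \<Omega> u (N + a) = distr_fun \<Omega> (\<lambda>x. max (u x - N) 0) a"
    using eventually_ge_at_top[of 0]
    by eventually_elim (simp add: distr_fun_truncate nonneg N)
  ultimately have "(distr_fun \<Omega> (\<lambda>x. max (u x - N) 0) \<longlongrightarrow> 0) at_top"
    by (rule Lim_transform_eventually)
  with u show ?thesis by (auto simp: rearrangeable_def)
qed

text \<open>Truncating at \<open>N\<close> shifts the distribution function by \<open>N\<close>.
  Hence both sides exceed the same nonnegative numbers \<open>a\<close>, and two nonnegative reals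
  with this property are equal.\<close>

lemma decr_rearr_truncate:
  assumes \<Omega>: "\<Omega> \<in> sets lebesgue" and u: "rearrangeable \<Omega> u"
    and nonneg: "\<And>x. x \<in> \<Omega> \<Longrightarrow> 0 \<le> u x" and "0 \<le> N" "0 < s"
  shows "decr_rearr \<Omega> (\<lambda>x. max (u x - N) 0) s = max (decr_rearr \<Omega> u s - N) 0"
    (is "?l = ?r")
proof -
  have "a < ?l \<longleftrightarrow> a < ?r" if "0 \<le> a" for a
    using that assms less_decr_rearr_iff[OF \<Omega> rearrangeable_truncate[OF u nonneg \<open>0 \<le> N\<close>] \<open>0 < s\<close> that]
      less_decr_rearr_iff[OF \<Omega> u \<open>0 < s\<close>, of "N + a"]
    by (auto simp: distr_fun_truncate)
  moreover have "0 \<le> ?l" "0 \<le> ?r" by (auto simp: decr_rearr_nonneg)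
  ultimately show ?thesis by (metis linorder_neqE_linordered_idom less_irrefl)
qed

section \<open>Integrability and decay of the excess over high levels\<close>

lemma suminf_indicator_less:
  "(\<Sum>n. if real n < d then 1 else 0 :: ennreal) = of_nat (nat \<lceil>d\<rceil>)"
proof -
  \<comment> \<open>The sum counts the naturals below \<open>d\<close>. This number lies between the
    positive part of \<open>d\<close> and that part plus 1, which is what both comparisons with
    integrals use.\<close>
  have *: "real n < d \<longleftrightarrow> n < nat \<lceil>d\<rceil>" for n by linarith
  have "(\<Sum>n. if real n < d then 1 else 0 :: ennreal) = (\<Sum>n<nat \<lceil>d\<rceil>. if real n < d then 1 else 0)"
    by (intro suminf_finite) (auto simp: *)
  also have "\<dots> = of_nat (nat \<lceil>d\<rceil>)" by (simp add: *)
  finally show ?thesis .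
qed

text \<open>A discrete layer-cake argument: both integrals are compared with the sum of the values
  of the distribution function at \<open>N + n\<close>.\<close>

lemma nn_integral_excess_finite:
  assumes \<Omega>: "\<Omega> \<in> sets lebesgue" and u: "rearrangeable \<Omega> u"
    and nonneg: "\<And>x. x \<in> \<Omega> \<Longrightarrow> 0 \<le> u x"
    and int: "set_integrable lebesgue {0<..<1} (decr_rearr \<Omega> u)"
    and N: "0 \<le> N" "distr_fun \<Omega> u N \<le> 1"
  shows "(\<integral>\<^sup>+x\<in>\<Omega>. ennreal (u x - N) \<partial>lebesgue) < \<infinity>"
proof -
  let ?g = "decr_rearr \<Omega> u"
  have um: "u \<in> borel_measurable (lebesgue_on \<Omega>)" using u by (simp add: rearrangeable_def)
  have [measurable]: "(\<lambda>s. indicator {0<..<1} s *\<^sub>R ?g s) \<in> borel_measurable lebesgue"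
    using int unfolding set_integrable_def by blast
  have sup: "{x\<in>\<Omega>. N + real n < u x} \<in> sets lebesgue" for n
    by (rule superlevel_sets_lebesgue[OF \<Omega> um])
  \<comment> \<open>Since the distribution function is at most 1 from level \<open>N\<close> on, the
    points \<open>s\<close> where the rearrangement exceeds \<open>N + real n\<close> form an
    interval from 0 of exactly that length inside the unit interval. Integrability of the
    rearrangement near 0 therefore suffices.\<close>
  have level: "distr_fun \<Omega> u (N + real n)
      = (\<integral>\<^sup>+s. (if 0 < s \<and> s < 1 \<and> N + real n < ?g s then 1 else 0) \<partial>lebesgue)" for n
  proof -
    let ?\<mu> = "distr_fun \<Omega> u (N + real n)"
    have "?\<mu> \<le> 1" using distr_fun_antimono[OF \<Omega> um, of N "N + real n"] N by simp
    then obtain r where r: "?\<mu> = ennreal r" "0 \<le> r" "r \<le> 1"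
      by (cases ?\<mu>) (auto simp: top_unique)
    have "(if 0 < s \<and> s < 1 \<and> N + real n < ?g s then 1 else 0 :: ennreal) = indicator {0<..<r} s" for s
      using less_decr_rearr_iff[OF \<Omega> u, of s "N + real n"] r N
      by (auto simp: indicator_def ennreal_less_iff)
    then show ?thesis using r by simp
  qed
  have "(\<integral>\<^sup>+x\<in>\<Omega>. ennreal (u x - N) \<partial>lebesgue)
      \<le> (\<integral>\<^sup>+x. (\<Sum>n. indicator {x\<in>\<Omega>. N + real n < u x} x) \<partial>lebesgue)"
  proof (rule nn_integral_mono)
    fix x
    show "ennreal (u x - N) * indicator \<Omega> x \<le> (\<Sum>n. indicator {x\<in>\<Omega>. N + real n < u x} x)"
    proof (cases "x \<in> \<Omega>")
      case True
      have "ennreal (u x - N) \<le> ennreal (real (nat \<lceil>u x - N\<rceil>))"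
        by (intro ennreal_leI) linarith
      also have "\<dots> = (\<Sum>n. if real n < u x - N then 1 else 0)"
        by (simp add: suminf_indicator_less ennreal_of_nat_eq_real_of_nat)
      also have "\<dots> = (\<Sum>n. indicator {x\<in>\<Omega>. N + real n < u x} x)"
        using True by (intro suminf_cong) (auto simp: indicator_def)
      finally show ?thesis using True by simp
    qed simp
  qed
  also have "\<dots> = (\<Sum>n. emeasure lebesgue {x\<in>\<Omega>. N + real n < u x})"
    using sup by (subst nn_integral_suminf) auto
  also have "\<dots> = (\<Sum>n. distr_fun \<Omega> u (N + real n))"
    unfolding distr_fun_def using nonneg
    by (intro suminf_cong arg_cong[of _ _ "emeasure lebesgue"]) auto
  also have "\<dots> = (\<integral>\<^sup>+s. (\<Sum>n. if 0 < s \<and> s < 1 \<and> N + real n < ?g s then 1 else 0) \<partial>lebesgue)"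
    unfolding level
  proof (rule nn_integral_suminf[symmetric])
    fix n
    \<comment> \<open>Measurability of the rearrangement is known only on the unit interval. Outside
      it the cut-off function is 0, which never exceeds the nonnegative level.\<close>
    have "(\<lambda>s. if 0 < s \<and> s < 1 \<and> N + real n < ?g s then 1 else 0 :: ennreal)
        = (\<lambda>s. if N + real n < indicator {0<..<1} s *\<^sub>R ?g s then 1 else 0)"
      using N by (auto simp: fun_eq_iff indicator_def)
    also have "\<dots> \<in> borel_measurable lebesgue" by measurable
    finally show "(\<lambda>s. if 0 < s \<and> s < 1 \<and> N + real n < ?g s then 1 else 0 :: ennreal)
        \<in> borel_measurable lebesgue" .
  qed
  also have "\<dots> \<le> (\<integral>\<^sup>+s. ennreal (indicator {0<..<1} s *\<^sub>R (?g s + 1)) \<partial>lebesgue)"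
  proof (rule nn_integral_mono)
    fix s
    show "(\<Sum>n. if 0 < s \<and> s < 1 \<and> N + real n < ?g s then 1 else 0)
        \<le> ennreal (indicator {0<..<1} s *\<^sub>R (?g s + 1))"
    proof (cases "0 < s \<and> s < 1")
      case True
      then have "(\<Sum>n. if 0 < s \<and> s < 1 \<and> N + real n < ?g s then 1 else 0 :: ennreal)
          = (\<Sum>n. if real n < ?g s - N then 1 else 0)"
        by (intro suminf_cong) auto
      also have "\<dots> = ennreal (real (nat \<lceil>?g s - N\<rceil>))"
        by (simp add: suminf_indicator_less ennreal_of_nat_eq_real_of_nat)
      also have "\<dots> \<le> ennreal (?g s + 1)"
        using N decr_rearr_nonneg[of \<Omega> u s] by (intro ennreal_leI) linarith
      finally show ?thesis using True by simp
    next
      case False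
      then have *: "(0 < s \<and> s < 1 \<and> P) = False" for P by blast
      show ?thesis unfolding * by simp
    qed
  qed
  also have "\<dots> < \<infinity>"
  proof -
    have "set_integrable lebesgue {0<..<1} (\<lambda>s. ?g s + 1)"
      using int by (intro set_integral_add(1) set_integrable_const) auto
    then have "(\<integral>\<^sup>+s. ennreal (norm (indicator {0<..<1} s *\<^sub>R (?g s + 1))) \<partial>lebesgue) < \<infinity>"
      unfolding set_integrable_def integrable_iff_bounded by blast
    moreover have "norm (indicator {0<..<1} s *\<^sub>R (?g s + 1)) = indicator {0<..<1} s *\<^sub>R (?g s + 1)" for s
      using decr_rearr_nonneg[of \<Omega> u s] by (auto simp: indicator_def)
    ultimately show ?thesis by simp
  qed
  finally show ?thesis .
qed

text \<open>Dominated convergence, with the excess over one level of finite integral as majorant. As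
  \<open>ennreal\<close> sends negative numbers to 0, the integrand is the positive part of
  \<open>u x - real n\<close>.\<close>

lemma nn_integral_excess_tendsto_0:
  fixes u :: "'a::euclidean_space \<Rightarrow> real"
  assumes \<Omega>: "\<Omega> \<in> sets lebesgue" and u: "rearrangeable \<Omega> u"
    and nonneg: "\<And>x. x \<in> \<Omega> \<Longrightarrow> 0 \<le> u x"
    and int: "set_integrable lebesgue {0<..<1} (decr_rearr \<Omega> u)"
  shows "(\<lambda>n. \<integral>\<^sup>+x\<in>\<Omega>. ennreal (u x - real n) \<partial>lebesgue) \<longlonglongrightarrow> 0"
proof -
  have um: "u \<in> borel_measurable (lebesgue_on \<Omega>)" using u by (simp add: rearrangeable_def)
  have meas: "(\<lambda>x. ennreal (u x - c) * indicator \<Omega> x) \<in> borel_measurable lebesgue" for c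
  proof -
    have "(\<lambda>x. ennreal (u x - c)) \<in> borel_measurable (lebesgue_on \<Omega>)" using um by measurable
    then show ?thesis using \<Omega> by (simp add: borel_measurable_restrict_space_iff_ennreal)
  qed
  have "\<forall>\<^sub>F a in at_top. distr_fun \<Omega> u a < 1"
    using u unfolding rearrangeable_def by (auto intro: order_tendstoD)
  then obtain B where B: "\<forall>a\<ge>B. distr_fun \<Omega> u a < 1"
    unfolding eventually_at_top_linorder by blast
  define N where "N = nat \<lceil>B\<rceil>"
  have "distr_fun \<Omega> u (real N) < 1" using B by (auto simp: N_def intro: of_nat_ceiling)
  then have fin: "(\<integral>\<^sup>+x\<in>\<Omega>. ennreal (u x - real N) \<partial>lebesgue) < \<infinity>"
    using assms by (intro nn_integral_excess_finite) auto
  \<comment> \<open>The sequence starts at \<open>N\<close>, since the excess over lower levels may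
    have infinite integral.\<close>
  have "(\<lambda>n. \<integral>\<^sup>+x\<in>\<Omega>. ennreal (u x - real (n + N)) \<partial>lebesgue) \<longlonglongrightarrow> (\<integral>\<^sup>+x. 0 \<partial>(lebesgue :: 'a measure))"
  proof (rule nn_integral_dominated_convergence[where w = "\<lambda>x. ennreal (u x - real N) * indicator \<Omega> x"])
    show "AE x in lebesgue. ennreal (u x - real (n + N)) * indicator \<Omega> x
        \<le> ennreal (u x - real N) * indicator \<Omega> x" for n
      by (intro AE_I2 mult_right_mono ennreal_leI) auto
    show "AE x in lebesgue. (\<lambda>n. ennreal (u x - real (n + N)) * indicator \<Omega> x) \<longlonglongrightarrow> 0"
    proof (rule AE_I2)
      fix x
      have "ennreal (u x - real (n + N)) * indicator \<Omega> x = 0" if "n \<ge> nat \<lceil>u x\<rceil>" for n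
      proof -
        have "u x - real (n + N) \<le> 0" using that by linarith
        then show ?thesis by (simp add: ennreal_neg)
      qed
      then show "(\<lambda>n. ennreal (u x - real (n + N)) * indicator \<Omega> x) \<longlonglongrightarrow> 0"
        by (intro tendsto_eventually eventually_sequentiallyI)
    qed
  qed (rule meas fin borel_measurable_const)+
  then show ?thesis
    using LIMSEQ_offset[where k = N and a = 0 and f = "\<lambda>n. \<integral>\<^sup>+x\<in>\<Omega>. ennreal (u x - real n) \<partial>lebesgue"]
    by simp
qed

section \<open>Shapes, the seminorm of the excess, and the absence of gaps in the range\<close>

lemma shape_lmeasurable:
  assumes "basis_of_shapes \<Omega> \<S>" "S \<in> \<S>"
  shows "S \<in> lmeasurable" "0 < measure lebesgue S" "S \<subseteq> \<Omega>"
proof -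
  have S: "open S" "S \<subseteq> \<Omega>" "0 < emeasure lebesgue S" "emeasure lebesgue S < \<infinity>"
    using assms unfolding basis_of_shapes_def by auto
  then show "S \<in> lmeasurable" "S \<subseteq> \<Omega>" by (auto intro!: fmeasurableI)
  then show "0 < measure lebesgue S"
    using S by (simp add: measure_def enn2real_positive_iff fmeasurableD2 less_top)
qed

lemma VMO_mean_osc_small:
  assumes "f \<in> VMO \<S>" "0 < e"
  obtains \<delta> where "0 < \<delta>" "\<And>S. S \<in> \<S> \<Longrightarrow> measure lebesgue S \<le> \<delta> \<Longrightarrow> mean_osc f S \<le> e"
proof -
  let ?w = "\<lambda>\<delta>::real. SUP S\<in>{S\<in>\<S>. measure lebesgue S \<le> \<delta>}. ennreal (mean_osc f S)"
  have "(?w \<longlongrightarrow> 0) (at_right 0)" using assms(1) by (simp add: VMO_def)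
  then have "\<forall>\<^sub>F \<delta> in at_right 0. ?w \<delta> < ennreal e"
    by (rule order_tendstoD) (use assms in simp)
  then have "\<forall>\<^sub>F \<delta> in at_right 0. ?w \<delta> < ennreal e \<and> 0 < \<delta>"
    using eventually_at_right_less by (rule eventually_conj)
  then obtain \<delta> where \<delta>: "?w \<delta> < ennreal e" "0 < \<delta>"
    using eventually_happens'[of "at_right (0::real)"] by auto
  show ?thesis
  proof
    fix S assume "S \<in> \<S>" "measure lebesgue S \<le> \<delta>"
    then have "ennreal (mean_osc f S) \<le> ?w \<delta>" by (intro SUP_upper) auto
    also have "\<dots> \<le> ennreal e" using \<delta> by simp
    finally show "mean_osc f S \<le> e" using assms(2) by (simp add: ennreal_le_iff)
  qed (fact \<delta>(2))
qed

lemma bmo_seminorm_le: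
  assumes "\<And>S. S \<in> \<S> \<Longrightarrow> mean_osc u S \<le> e"
  shows "bmo_seminorm \<S> u \<le> ennreal e"
  unfolding bmo_seminorm_def using assms by (intro SUP_least ennreal_leI)

text \<open>This makes the assumed rearrangement inequality applicable to truncated
  functions.\<close>

lemma BMO_truncate:
  assumes \<S>: "basis_of_shapes \<Omega> \<S>" and u: "u \<in> BMO \<S>"
  shows "(\<lambda>x. max (u x - N) 0) \<in> BMO \<S>"
proof -
  have int: "set_integrable lebesgue S u" if "S \<in> \<S>" for S
    using u that by (simp add: BMO_def)
  have "bmo_seminorm \<S> u < \<infinity>" using u by (simp add: BMO_def)
  then obtain b where b: "bmo_seminorm \<S> u = ennreal b" "0 \<le> b"
    by (cases "bmo_seminorm \<S> u") auto
  have "mean_osc (\<lambda>x. max (u x - N) 0) S \<le> 2 * b" if "S \<in> \<S>" for S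
    using mean_osc_truncate_le[OF shape_lmeasurable(1,2)[OF \<S> that] int[OF that], of N]
      mean_osc_le_bmo_seminorm[OF that, of u b] b by simp
  then have "bmo_seminorm \<S> (\<lambda>x. max (u x - N) 0) \<le> ennreal (2 * b)" by (rule bmo_seminorm_le)
  then have "bmo_seminorm \<S> (\<lambda>x. max (u x - N) 0) < \<infinity>"
    by (rule le_less_trans) simp
  moreover have "set_integrable lebesgue S (\<lambda>x. max (u x - N) 0)" if "S \<in> \<S>" for S
    using shape_lmeasurable(1)[OF \<S> that] int[OF that] by (intro set_integrable_intros)
  ultimately show ?thesis by (simp add: BMO_def)
qed

text \<open>Small shapes are controlled by vanishing mean oscillation, large ones by the small integral
  of the excess over \<open>\<Omega>\<close>. The bound is uniform over all functions below \<open>f\<close> that are BMO-close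
  to \<open>f\<close>.\<close>

lemma bmo_seminorm_excess_small:
  assumes \<Omega>: "\<Omega> \<in> sets lebesgue" and \<S>: "basis_of_shapes \<Omega> \<S>"
    and f: "rearrangeable \<Omega> f" "f \<in> VMO \<S>" and nonneg: "\<And>x. x \<in> \<Omega> \<Longrightarrow> 0 \<le> f x"
    and int: "set_integrable lebesgue {0<..<1} (decr_rearr \<Omega> f)"
    and "0 < e"
  obtains n where "B \<le> real n"
    "\<And>u. u \<in> BMO \<S> \<Longrightarrow> (\<And>x. x \<in> \<Omega> \<Longrightarrow> u x \<le> f x)
      \<Longrightarrow> bmo_seminorm \<S> (\<lambda>x. u x - f x) \<le> ennreal (e / 4)
      \<Longrightarrow> bmo_seminorm \<S> (\<lambda>x. max (u x - real n) 0) \<le> ennreal e"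
proof -
  \<comment> \<open>On small shapes \<open>f\<close> and \<open>u - f\<close> each contribute
    \<open>e / 4\<close>, so \<open>u\<close> oscillates by at most \<open>e / 2\<close>, and
    truncation doubles this to \<open>e\<close>.\<close>
  obtain \<delta> where \<delta>: "0 < \<delta>" "\<And>S. S \<in> \<S> \<Longrightarrow> measure lebesgue S \<le> \<delta> \<Longrightarrow> mean_osc f S \<le> e / 4"
    using VMO_mean_osc_small[OF f(2), of "e / 4"] \<open>0 < e\<close> by auto
  let ?I = "\<lambda>n. \<integral>\<^sup>+x\<in>\<Omega>. ennreal (f x - real n) \<partial>lebesgue"
  \<comment> \<open>On shapes of measure above \<open>\<delta>\<close>, comparison with the constant
    0 multiplies this bound by at most \<open>2 / \<delta>\<close>, giving \<open>e\<close>.\<close>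
  have "\<forall>\<^sub>F n in sequentially. ?I n < ennreal (e * \<delta> / 2)"
    using nn_integral_excess_tendsto_0[OF \<Omega> f(1) nonneg int]
    by (rule order_tendstoD) (use \<delta> \<open>0 < e\<close> in simp_all)
  moreover have "\<forall>\<^sub>F n in sequentially. B \<le> real n"
    by (rule eventually_sequentiallyI[of "nat \<lceil>B\<rceil>"]) linarith
  ultimately have "\<forall>\<^sub>F n in sequentially. ?I n < ennreal (e * \<delta> / 2) \<and> B \<le> real n"
    by (rule eventually_conj)
  then obtain n where n: "?I n < ennreal (e * \<delta> / 2)" "B \<le> real n"
    unfolding eventually_sequentially by blast
  show ?thesis
  proof (rule that[OF n(2)])
    fix u assume u: "u \<in> BMO \<S>" "\<And>x. x \<in> \<Omega> \<Longrightarrow> u x \<le> f x"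
      "bmo_seminorm \<S> (\<lambda>x. u x - f x) \<le> ennreal (e / 4)"
    show "bmo_seminorm \<S> (\<lambda>x. max (u x - real n) 0) \<le> ennreal e"
    proof (rule bmo_seminorm_le)
      fix S assume S: "S \<in> \<S>"
      note Sm = shape_lmeasurable[OF \<S> S]
      have fint: "set_integrable lebesgue S f" and uint: "set_integrable lebesgue S u"
        using f(2) u(1) S by (auto simp: VMO_def BMO_def)
      let ?v = "\<lambda>x. max (u x - real n) 0"
      have vint: "set_integrable lebesgue S ?v"
        using Sm uint by (intro set_integrable_intros)
      show "mean_osc ?v S \<le> e"
      proof (cases "measure lebesgue S \<le> \<delta>")
        case True
        have d: "mean_osc (\<lambda>x. u x - f x) S \<le> e / 4"
          using mean_osc_le_bmo_seminorm[OF S u(3)] \<open>0 < e\<close> by simp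
        \<comment> \<open>\<open>mean_osc_diff_le\<close> concerns differences, so \<open>u\<close>
          is written as one; applying it again to \<open>0 - f x\<close> removes the sign.\<close>
        have "mean_osc u S = mean_osc (\<lambda>x. (u x - f x) - (- f x)) S" by simp
        also have "\<dots> \<le> mean_osc (\<lambda>x. u x - f x) S + mean_osc (\<lambda>x. 0 - f x) S"
          using Sm fint uint mean_osc_diff_le[of S "\<lambda>x. u x - f x" "\<lambda>x. 0 - f x"]
            set_integral_diff(1)[OF set_integrable_const[of S 0], of f]
          by (simp add: set_integral_diff(1))
        also have "mean_osc (\<lambda>x. 0 - f x) S \<le> mean_osc (\<lambda>x. 0) S + mean_osc f S"
          using Sm fint by (intro mean_osc_diff_le set_integrable_intros)
        also have "mean_osc (\<lambda>x. 0) S = 0" by (simp add: mean_osc_def mean_def)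
        finally have "mean_osc u S \<le> e / 2" using d \<delta>(2)[OF S True] by simp
        then show ?thesis using mean_osc_truncate_le[OF Sm(1,2) uint, of "real n"] by linarith
      next
        case False
        have "ennreal (LINT x:S|lebesgue. ?v x) = (\<integral>\<^sup>+x. ennreal (indicator S x *\<^sub>R ?v x) \<partial>lebesgue)"
          unfolding set_lebesgue_integral_def
          using vint by (intro nn_integral_eq_integral[symmetric]) (auto simp: set_integrable_def)
        also have "\<dots> \<le> ?I n"
        proof (rule nn_integral_mono)
          fix x
          show "ennreal (indicator S x *\<^sub>R ?v x) \<le> ennreal (f x - real n) * indicator \<Omega> x"
          proof (cases "x \<in> S")
            case True
            then have "x \<in> \<Omega>" using Sm by auto
            have "ennreal (?v x) = ennreal (u x - real n)"
              by (cases "real n \<le> u x") (auto simp: max_def ennreal_neg)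
            also have "\<dots> \<le> ennreal (f x - real n)"
              using u(2)[OF \<open>x \<in> \<Omega>\<close>] by (intro ennreal_leI) simp
            finally show ?thesis using True \<open>x \<in> \<Omega>\<close> by simp
          qed simp
        qed
        also have "\<dots> \<le> ennreal (e * \<delta> / 2)" using n(1) by simp
        finally have I: "(LINT x:S|lebesgue. ?v x) \<le> e * \<delta> / 2"
          using \<delta>(1) \<open>0 < e\<close> by (subst (asm) ennreal_le_iff) auto
        have "mean_osc ?v S \<le> 2 / measure lebesgue S * (LINT x:S|lebesgue. \<bar>?v x - 0\<bar>)"
          by (rule mean_osc_le_dist_const[OF Sm(1,2) vint])
        also have "\<dots> = 2 / measure lebesgue S * (LINT x:S|lebesgue. ?v x)" by simp
        also have "\<dots> \<le> 2 / measure lebesgue S * (e * \<delta> / 2)"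
          using I Sm by (intro mult_left_mono) auto
        also have "\<dots> \<le> e" using False Sm \<open>0 < e\<close> by (simp add: field_simps)
        finally show ?thesis .
      qed
    qed
  qed
qed

text \<open>A gap in the range of \<open>f\<close> would give it an oscillation of fixed size on arbitrarily small
  shapes, by the density condition.\<close>

lemma distr_fun_strict_antimono:
  assumes \<Omega>: "\<Omega> \<in> sets lebesgue" "emeasure lebesgue \<Omega> = \<infinity>" and \<S>: "basis_of_shapes \<Omega> \<S>"
    and dens: "density_condition \<Omega> \<S>"
    and f: "f \<in> borel_measurable (lebesgue_on \<Omega>)" "f \<in> VMO \<S>"
    and nonneg: "\<And>x. x \<in> \<Omega> \<Longrightarrow> 0 \<le> f x"
    and t: "t < t'" and pos: "0 < distr_fun \<Omega> f t'" and fin: "distr_fun \<Omega> f t' < \<infinity>"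
  shows "distr_fun \<Omega> f t' < distr_fun \<Omega> f t"
proof (rule ccontr)
  assume "\<not> ?thesis"
  with distr_fun_antimono[OF \<Omega>(1) f(1), of t t'] t
  have eq: "distr_fun \<Omega> f t = distr_fun \<Omega> f t'" by simp
  define E where "E = {x\<in>\<Omega>. t < f x}"
  define E' where "E' = {x\<in>\<Omega>. t' < f x}"
  have meas: "E \<in> sets lebesgue" "E' \<in> sets lebesgue"
    unfolding E_def E'_def by (intro superlevel_sets_lebesgue \<Omega> f)+
  have "distr_fun \<Omega> f a = emeasure lebesgue {x\<in>\<Omega>. a < f x}" for a
    unfolding distr_fun_def using nonneg by (intro arg_cong[of _ _ "emeasure lebesgue"]) auto
  then have em: "emeasure lebesgue E = distr_fun \<Omega> f t" "emeasure lebesgue E' = distr_fun \<Omega> f t'"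
    by (auto simp: E_def E'_def)
  have "emeasure lebesgue (E - E') = emeasure lebesgue E - emeasure lebesgue E'"
    using meas em fin t by (intro emeasure_Diff) (auto simp: E_def E'_def)
  also have "\<dots> = 0" using eq em fin by simp
  finally have null: "E - E' \<in> null_sets lebesgue" using meas by auto
  have above: "AE x in lebesgue. x \<in> E \<inter> S \<longrightarrow> t' \<le> f x" for S
    using AE_not_in[OF null] by eventually_elim (auto simp: E_def E'_def)
  obtain q where q: "0 < q" and lim: "\<forall>E. E \<in> sets lebesgue \<and> E \<subseteq> \<Omega> \<and> 0 < emeasure lebesgue E
      \<and> 0 < emeasure lebesgue (\<Omega> - E) \<longrightarrow>
        Limsup (shrinking \<S>) (\<lambda>S. ereal (shape_density E S * (1 - shape_density E S))) \<ge> ereal q"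
    using dens unfolding density_condition_def by blast
  \<comment> \<open>The infinite measure of \<open>\<Omega>\<close> enters here: \<open>E\<close>
    has finite measure, so its complement is not null and the density condition applies to
    \<open>E\<close>.\<close>
  have "emeasure lebesgue (\<Omega> - E) = \<infinity>"
    using \<Omega> meas em eq fin by (subst emeasure_Diff) (auto simp: E_def)
  with lim meas em pos eq
  have L: "ereal q \<le> Limsup (shrinking \<S>) (\<lambda>S. ereal (shape_density E S * (1 - shape_density E S)))"
    by (auto simp: E_def)
  define d where "d = (t' - t) / 2"
  have "0 < d" using t by (simp add: d_def)
  \<comment> \<open>By \<open>mean_osc_ge_gap\<close>, an oscillation of at most
    \<open>d * (q / 2)\<close> keeps the density product at most \<open>q / 2\<close>, strictly
    below the \<open>q\<close> that the upper limit must reach.\<close>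
  obtain \<delta> where \<delta>: "0 < \<delta>" "\<And>S. S \<in> \<S> \<Longrightarrow> measure lebesgue S \<le> \<delta> \<Longrightarrow> mean_osc f S \<le> d * (q / 2)"
    using VMO_mean_osc_small[OF f(2), of "d * (q / 2)"] \<open>0 < d\<close> q by auto
  have "\<forall>\<^sub>F x in at_right (0::real). x \<le> \<delta>"
    using \<delta>(1) by (auto simp: eventually_at_right intro: exI[of _ \<delta>])
  then have "\<forall>\<^sub>F S in shrinking \<S>. S \<in> \<S> \<and> measure lebesgue S \<le> \<delta>"
    unfolding shrinking_def eventually_inf_principal eventually_filtercomap
    by (auto intro!: exI[of _ "\<lambda>x. x \<le> \<delta>"])
  then have "\<forall>\<^sub>F S in shrinking \<S>. ereal (shape_density E S * (1 - shape_density E S)) \<le> ereal (q / 2)"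
  proof eventually_elim
    fix S assume S: "S \<in> \<S> \<and> measure lebesgue S \<le> \<delta>"
    note Sm = shape_lmeasurable[OF \<S>, of S]
    have "d * (shape_density E S * (1 - shape_density E S)) \<le> mean_osc f S"
      unfolding d_def
    proof (rule mean_osc_ge_gap)
      show "set_integrable lebesgue S f" using f(2) S by (simp add: VMO_def BMO_def)
      show "f x \<le> t" if "x \<in> S - E" for x using that Sm S by (force simp: E_def)
    qed (use Sm S meas t above in auto)
    also have "\<dots> \<le> d * (q / 2)" using \<delta>(2) S by blast
    finally show "ereal (shape_density E S * (1 - shape_density E S)) \<le> ereal (q / 2)"
      using \<open>0 < d\<close> by (subst (asm) mult_le_cancel_left_pos) auto
  qed
  then have "Limsup (shrinking \<S>) (\<lambda>S. ereal (shape_density E S * (1 - shape_density E S))) \<le> ereal (q / 2)"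
    by (rule Limsup_bounded)
  with L q show False using order.trans by fastforce
qed

section \<open>Monotone convergence of distribution functions and clamped rearrangements\<close>

lemma LIMSEQ_distr_fun_incseq:
  assumes \<Omega>: "\<Omega> \<in> sets lebesgue"
    and F: "\<And>k. F k \<in> borel_measurable (lebesgue_on \<Omega>)"
    and nonneg: "\<And>k x. x \<in> \<Omega> \<Longrightarrow> 0 \<le> F k x"
    and inc: "\<And>x. x \<in> \<Omega> \<Longrightarrow> incseq (\<lambda>k. F k x)"
    and lim: "\<And>x. x \<in> \<Omega> \<Longrightarrow> (\<lambda>k. F k x) \<longlonglongrightarrow> f x"
  shows "(\<lambda>k. distr_fun \<Omega> (F k) t) \<longlonglongrightarrow> distr_fun \<Omega> f t"
proof -
  let ?A = "\<lambda>k. {x\<in>\<Omega>. t < \<bar>F k x\<bar>}"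
  have le: "F k x \<le> f x" if "x \<in> \<Omega>" for k x
    using incseq_le[OF inc[OF that] lim[OF that]] .
  have "incseq ?A"
  proof (rule incseq_SucI, rule subsetI)
    fix k x assume x: "x \<in> ?A k"
    then have "F k x \<le> F (Suc k) x" using inc[of x] by (auto intro: incseq_SucD)
    with x nonneg[of x k] nonneg[of x "Suc k"] show "x \<in> ?A (Suc k)" by auto
  qed
  moreover have "range ?A \<subseteq> sets lebesgue"
    using abs_superlevel_sets_lebesgue[OF \<Omega> F] by auto
  moreover have "(\<Union>k. ?A k) = {x\<in>\<Omega>. t < \<bar>f x\<bar>}"
  proof (intro equalityI subsetI)
    fix x assume "x \<in> (\<Union>k. ?A k)"
    then obtain k where "x \<in> \<Omega>" "t < \<bar>F k x\<bar>" by blast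
    with le[of x k] nonneg[of x k] show "x \<in> {x\<in>\<Omega>. t < \<bar>f x\<bar>}" by auto
  \<comment> \<open>A strict inequality for the limit already holds for large \<open>k\<close>. So
    the superlevel sets of \<open>F k\<close> exhaust that of \<open>f\<close>, and continuity of
    the measure from below gives the claim, also for infinite values.\<close>
  next
    fix x assume x: "x \<in> {x\<in>\<Omega>. t < \<bar>f x\<bar>}"
    then have "(\<lambda>k. \<bar>F k x\<bar>) \<longlonglongrightarrow> \<bar>f x\<bar>" using lim by (auto intro: tendsto_rabs)
    then have "\<forall>\<^sub>F k in sequentially. t < \<bar>F k x\<bar>"
      using x by (auto intro: order_tendstoD)
    with x show "x \<in> (\<Union>k. ?A k)" unfolding eventually_sequentially by auto
  qed
  ultimately show ?thesis
    using Lim_emeasure_incseq[of ?A lebesgue] by (simp add: distr_fun_def)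
qed

lemma decr_rearr_mono:
  assumes \<Omega>: "\<Omega> \<in> sets lebesgue" and u: "rearrangeable \<Omega> u" and v: "rearrangeable \<Omega> v"
    and le: "\<And>x. x \<in> \<Omega> \<Longrightarrow> \<bar>u x\<bar> \<le> \<bar>v x\<bar>" and s: "0 < s"
  shows "decr_rearr \<Omega> u s \<le> decr_rearr \<Omega> v s"
proof (rule ccontr)
  assume "\<not> ?thesis"
  then have "ennreal s < distr_fun \<Omega> u (decr_rearr \<Omega> v s)"
    using less_decr_rearr_iff[OF \<Omega> u s decr_rearr_nonneg[of \<Omega> v s]] by simp
  also have "\<dots> \<le> distr_fun \<Omega> v (decr_rearr \<Omega> v s)"
    unfolding distr_fun_def using le v
    by (intro emeasure_mono abs_superlevel_sets_lebesgue \<Omega>) (auto simp: rearrangeable_def intro: less_le_trans)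
  finally show False using less_decr_rearr_iff[OF \<Omega> v s decr_rearr_nonneg[of \<Omega> v s]] by simp
qed

text \<open>A Dini argument on finitely many levels between \<open>L\<close> and \<open>N\<close>. Strict monotonicity of the
  distribution function of \<open>f\<close> replaces continuity of its rearrangement.\<close>

lemma clamped_decr_rearr_uniform_limit:
  assumes \<Omega>: "\<Omega> \<in> sets lebesgue"
    and F: "\<And>k. rearrangeable \<Omega> (F k)" and f: "rearrangeable \<Omega> f"
    and nonneg: "\<And>k x. x \<in> \<Omega> \<Longrightarrow> 0 \<le> F k x"
    and inc: "\<And>x. x \<in> \<Omega> \<Longrightarrow> incseq (\<lambda>k. F k x)"
    and lim: "\<And>x. x \<in> \<Omega> \<Longrightarrow> (\<lambda>k. F k x) \<longlonglongrightarrow> f x"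
    and L: "0 \<le> L" "L \<le> N"
    and strict: "\<And>t t'. L \<le> t \<Longrightarrow> t < t' \<Longrightarrow> 0 < distr_fun \<Omega> f t' \<Longrightarrow> distr_fun \<Omega> f t' < distr_fun \<Omega> f t"
    and "0 < e"
  shows "\<forall>\<^sub>F k in sequentially. \<forall>s>0.
    \<bar>max L (min N (decr_rearr \<Omega> (F k) s)) - max L (min N (decr_rearr \<Omega> f s))\<bar> \<le> e"
proof -
  define d where "d = e / 2"
  have d: "0 < d" using \<open>0 < e\<close> by (simp add: d_def)
  \<comment> \<open>Levels are spaced by \<open>e / 2\<close> so that two consecutive steps cost
    \<open>e\<close>: one places a level strictly below the value of the rearrangement of
    \<open>f\<close>, the other is lost in passing to \<open>F k\<close>.\<close>
  define lv where "lv i = L + real i * d" for i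
  define M where "M = nat \<lceil>(N - L) / d\<rceil>"
  \<comment> \<open>Convergence at level \<open>lv i\<close> eventually lifts the distribution
    function of \<open>F k\<close> above the strictly smaller value of that of \<open>f\<close> one
    level higher. Strictness is available only from \<open>L\<close> upwards, hence the clamping
    from below.\<close>
  have "\<forall>\<^sub>F k in sequentially. 0 < distr_fun \<Omega> f (lv (Suc i)) \<longrightarrow>
      distr_fun \<Omega> f (lv (Suc i)) < distr_fun \<Omega> (F k) (lv i)" for i
  proof (cases "0 < distr_fun \<Omega> f (lv (Suc i))")
    case True
    have "distr_fun \<Omega> f (lv (Suc i)) < distr_fun \<Omega> f (lv i)"
      using True d by (intro strict) (auto simp: lv_def algebra_simps)
    moreover have "(\<lambda>k. distr_fun \<Omega> (F k) (lv i)) \<longlonglongrightarrow> distr_fun \<Omega> f (lv i)"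
      using F by (intro LIMSEQ_distr_fun_incseq \<Omega> nonneg inc lim) (auto simp: rearrangeable_def)
    ultimately have "\<forall>\<^sub>F k in sequentially. distr_fun \<Omega> f (lv (Suc i)) < distr_fun \<Omega> (F k) (lv i)"
      by (metis order_tendstoD(1))
    then show ?thesis by eventually_elim simp
  qed simp
  then have "\<forall>\<^sub>F k in sequentially. \<forall>i\<in>{..M}. 0 < distr_fun \<Omega> f (lv (Suc i)) \<longrightarrow>
      distr_fun \<Omega> f (lv (Suc i)) < distr_fun \<Omega> (F k) (lv i)"
    by (intro eventually_ball_finite) auto
  then show ?thesis
  proof eventually_elim
    fix k assume k: "\<forall>i\<in>{..M}. 0 < distr_fun \<Omega> f (lv (Suc i)) \<longrightarrow>
      distr_fun \<Omega> f (lv (Suc i)) < distr_fun \<Omega> (F k) (lv i)"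
    show "\<forall>s>0. \<bar>max L (min N (decr_rearr \<Omega> (F k) s)) - max L (min N (decr_rearr \<Omega> f s))\<bar> \<le> e"
    proof (intro allI impI)
      fix s :: real assume s: "0 < s"
      have "F k x \<le> f x" if "x \<in> \<Omega>" for x
        using incseq_le[OF inc[OF that] lim[OF that]] .
      then have le: "decr_rearr \<Omega> (F k) s \<le> decr_rearr \<Omega> f s"
        using nonneg by (intro decr_rearr_mono \<Omega> F f s) fastforce
      define y where "y = min N (decr_rearr \<Omega> f s)"
      \<comment> \<open>Only this side needs proof, because the rearrangements of \<open>F k\<close>
        stay below that of \<open>f\<close>. For \<open>y\<close> up to \<open>L + e\<close> it is
        trivial.\<close>
      have "y \<le> max L (min N (decr_rearr \<Omega> (F k) s)) + e"
      proof (cases "y \<le> L + e")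
        case False
        \<comment> \<open>The index places \<open>y\<close> above \<open>lv (Suc i)\<close> and at
          most at \<open>lv (Suc (Suc i))\<close>. The quotient exceeds 2, so the natural
          subtraction does not truncate.\<close>
        define i where "i = nat \<lceil>(y - L) / d\<rceil> - 2"
        have "2 < (y - L) / d" using False d by (simp add: d_def field_simps)
        then have i: "real i + 1 < (y - L) / d" "(y - L) / d \<le> real i + 2"
          unfolding i_def by linarith+
        then have lo: "lv (Suc i) < y" and hi: "y \<le> lv i + e"
          using d by (auto simp: lv_def d_def field_simps)
        have "(y - L) / d \<le> (N - L) / d" using d by (intro divide_right_mono) (auto simp: y_def)
        then have "i \<in> {..M}" using i(1) unfolding M_def atMost_iff by linarith
        moreover have "ennreal s < distr_fun \<Omega> f (lv (Suc i))"
          using lo L d by (subst less_decr_rearr_iff[OF \<Omega> f s, symmetric]) (auto simp: y_def lv_def)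
        ultimately have "ennreal s < distr_fun \<Omega> (F k) (lv i)"
          using k by (metis less_trans order_le_less_trans zero_le)
        then have "lv i < decr_rearr \<Omega> (F k) s"
          using L d by (subst less_decr_rearr_iff[OF \<Omega> F s]) (auto simp: lv_def)
        moreover have "lv i \<le> lv (Suc i)" using d by (simp add: lv_def algebra_simps)
        ultimately have "lv i \<le> min N (decr_rearr \<Omega> (F k) s)" using lo by (auto simp: y_def)
        then show ?thesis using hi by linarith
      qed simp
      then show "\<bar>max L (min N (decr_rearr \<Omega> (F k) s)) - max L (min N (decr_rearr \<Omega> f s))\<bar> \<le> e"
        using le \<open>0 < e\<close> unfolding y_def by (auto simp: max_def min_def abs_if split: if_splits)
    qed
  qed
qed

section \<open>Convergence of the rearrangements in the seminorm\<close>

lemma tendsto_zero_ennreal_iff: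
  fixes x :: "'a \<Rightarrow> ennreal"
  shows "(x \<longlongrightarrow> 0) G \<longleftrightarrow> (\<forall>e::real>0. \<forall>\<^sub>F k in G. x k \<le> ennreal e)"
proof (intro iffI allI impI)
  fix e :: real assume "(x \<longlongrightarrow> 0) G" "0 < e"
  then have "\<forall>\<^sub>F k in G. x k < ennreal e" by (intro order_tendstoD) auto
  then show "\<forall>\<^sub>F k in G. x k \<le> ennreal e" by eventually_elim simp
next
  assume *: "\<forall>e::real>0. \<forall>\<^sub>F k in G. x k \<le> ennreal e"
  show "(x \<longlongrightarrow> 0) G"
  proof (rule order_tendstoI)
    fix a :: ennreal assume "0 < a"
    then obtain b where b: "0 < b" "b < a" using dense by blast
    then obtain e where "b = ennreal e" "0 \<le> e" by (cases b) (auto simp: top_unique)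
    with b have "\<forall>\<^sub>F k in G. x k \<le> b" using * by auto
    then show "\<forall>\<^sub>F k in G. x k < a" by eventually_elim (use b in simp)
  qed simp
qed

theorem theorem4p10:
  fixes \<Omega> :: "(real ^ 'n) set" and \<S> :: "(real ^ 'n) set set"
    and c L :: real and F :: "nat \<Rightarrow> real ^ 'n \<Rightarrow> real" and f :: "real ^ 'n \<Rightarrow> real"
  assumes "domain \<Omega>" and "emeasure lebesgue \<Omega> = \<infinity>"
    and "basis_of_shapes \<Omega> \<S>"
    and "density_condition \<Omega> \<S>"
    and "\<And>g. g \<in> BMO \<S> \<Longrightarrow> rearrangeable \<Omega> g \<Longrightarrow>
           decr_rearr \<Omega> g \<in> BMO pos_intervals \<and>
           bmo_seminorm pos_intervals (decr_rearr \<Omega> g) \<le> ennreal c * bmo_seminorm \<S> g"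
    and "\<And>k. F k \<in> BMO \<S>" and "\<And>k. rearrangeable \<Omega> (F k)"
    and "f \<in> BMO \<S>" and "rearrangeable \<Omega> f"
    and "L = (INF s\<in>{0<..}. decr_rearr \<Omega> f s)"
    and "f \<in> VMO \<S>"
    and "converges_in_BMO \<S> F f"
    and "\<And>k x. x \<in> \<Omega> \<Longrightarrow> 0 \<le> F k x"
    and "\<And>x. x \<in> \<Omega> \<Longrightarrow> incseq (\<lambda>k. F k x)"
    and "\<And>x. x \<in> \<Omega> \<Longrightarrow> (\<lambda>k. F k x) \<longlonglongrightarrow> f x"
    and "converges_in_BMO pos_intervals (\<lambda>k s. max (L - decr_rearr \<Omega> (F k) s) 0) (\<lambda>s. 0)"
  shows "converges_in_BMO pos_intervals (\<lambda>k. decr_rearr \<Omega> (F k)) (decr_rearr \<Omega> f)"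
proof -
  note \<S> = assms(3) and bound = assms(5) and FB = assms(6) and Fr = assms(7)
    and fB = assms(8) and fr = assms(9) and L = assms(10) and conv = assms(12)
    and Fpos = assms(13) and inc = assms(14) and lim = assms(15) and low = assms(16)
  have \<Omega>: "\<Omega> \<in> sets lebesgue" using assms(1) by (auto simp: domain_def)
  have Fle: "F k x \<le> f x" if "x \<in> \<Omega>" for k x
    using incseq_le[OF inc[OF that] lim[OF that]] .
  have fpos: "0 \<le> f x" if "x \<in> \<Omega>" for x
    using Fpos[OF that, of 0] Fle[OF that, of 0] by linarith
  let ?g = "decr_rearr \<Omega> f" and ?G = "\<lambda>k. decr_rearr \<Omega> (F k)"
  have gB: "?g \<in> BMO pos_intervals" and GB: "?G k \<in> BMO pos_intervals" for k
    using bound FB Fr fB fr by auto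
  have int: "set_integrable lebesgue I ?g" "set_integrable lebesgue I (?G k)" if "I \<in> pos_intervals" for I k
    using gB GB that by (auto simp: BMO_def)
  have L0: "0 \<le> L" unfolding L by (intro cINF_greatest) (auto simp: decr_rearr_nonneg)
  have Lle: "L \<le> ?g s" if "0 < s" for s
    unfolding L using that by (intro cINF_lower bdd_belowI2[of _ 0]) (auto simp: decr_rearr_nonneg)
  have strict: "distr_fun \<Omega> f t' < distr_fun \<Omega> f t"
    if t: "L \<le> t" "t < t'" "0 < distr_fun \<Omega> f t'" for t t'
  proof (rule distr_fun_strict_antimono[OF \<Omega> assms(2) \<S> assms(4) _ assms(11) fpos t(2,3)])
    show "f \<in> borel_measurable (lebesgue_on \<Omega>)" using fr by (simp add: rearrangeable_def)
    \<comment> \<open>A level above the infimum exceeds the rearrangement at some \<open>s\<close>,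
      and this \<open>s\<close> bounds the distribution function there, which gives the
      finiteness.\<close>
    have "(INF s\<in>{0<..}. ?g s) < t'" using t L by simp
    then obtain s where "0 < s" "?g s < t'"
      by (subst (asm) cInf_less_iff) (auto simp: decr_rearr_nonneg intro!: bdd_belowI2[of _ 0])
    then have "\<not> ennreal s < distr_fun \<Omega> f t'"
      using less_decr_rearr_iff[OF \<Omega> fr, of s t'] t L0 by auto
    then show "distr_fun \<Omega> f t' < \<infinity>" using le_less_trans[of _ "ennreal s"] by auto
  qed auto
  \<comment> \<open>The constant \<open>c\<close> may be zero or negative, whereas \<open>d\<close>
    below is obtained by dividing by \<open>C\<close>.\<close>
  define C where "C = max c 1"
  have C: "1 \<le> C" "ennreal c \<le> ennreal C" by (auto simp: C_def intro!: ennreal_leI)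
  have excess: "bmo_seminorm pos_intervals (\<lambda>s. max (decr_rearr \<Omega> u s - N) 0) \<le> ennreal (C * d)"
    if u: "u \<in> BMO \<S>" "rearrangeable \<Omega> u" "\<And>x. x \<in> \<Omega> \<Longrightarrow> 0 \<le> u x" "0 \<le> N" "0 \<le> d"
      "bmo_seminorm \<S> (\<lambda>x. max (u x - N) 0) \<le> ennreal d" for u N d
  proof -
    have "bmo_seminorm pos_intervals (\<lambda>s. max (decr_rearr \<Omega> u s - N) 0)
        = bmo_seminorm pos_intervals (decr_rearr \<Omega> (\<lambda>x. max (u x - N) 0))"
      using u by (intro bmo_seminorm_cong decr_rearr_truncate[OF \<Omega>, symmetric]) (auto simp: pos_intervals_def)
    also have "\<dots> \<le> ennreal c * bmo_seminorm \<S> (\<lambda>x. max (u x - N) 0)"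
      using bound[OF BMO_truncate[OF \<S> u(1)] rearrangeable_truncate[OF u(2,3,4)]] by simp
    also have "\<dots> \<le> ennreal C * ennreal d" using C u by (intro mult_mono) auto
    finally show ?thesis using C u by (simp add: ennreal_mult)
  qed
  have "\<forall>\<^sub>F k in sequentially. bmo_seminorm pos_intervals (\<lambda>s. ?G k s - ?g s) \<le> ennreal e"
    if "0 < e" for e
  proof -
    \<comment> \<open>The budget \<open>e\<close> is split into four quarters: the middle part, the
      part below \<open>L\<close>, and the two excesses. The rearrangement inequality turns
      \<open>d\<close> into \<open>C * d\<close>, one quarter.\<close>
    define d where "d = e / (4 * C)"
    have d: "0 < d" "C * d = e / 4" using \<open>0 < e\<close> C by (auto simp: d_def)
    have int01: "set_integrable lebesgue {0<..<1} ?g" by (rule int) (force simp: pos_intervals_def)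
    obtain n where n: "L \<le> real n"
      "\<And>u. u \<in> BMO \<S> \<Longrightarrow> (\<And>x. x \<in> \<Omega> \<Longrightarrow> u x \<le> f x)
        \<Longrightarrow> bmo_seminorm \<S> (\<lambda>x. u x - f x) \<le> ennreal (d / 4)
        \<Longrightarrow> bmo_seminorm \<S> (\<lambda>x. max (u x - real n) 0) \<le> ennreal d"
      using bmo_seminorm_excess_small[OF \<Omega> \<S> fr assms(11) fpos int01 d(1), of L] by blast
    define N where "N = real n"
    \<comment> \<open>The uniform bound on excesses also covers \<open>f\<close> itself, whose
      distance to \<open>f\<close> is 0.\<close>
    have "bmo_seminorm \<S> (\<lambda>x. f x - f x) \<le> ennreal (d / 4)"
      by (rule bmo_seminorm_le) (use d in \<open>simp add: mean_osc_def mean_def\<close>)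
    then have f_excess: "bmo_seminorm pos_intervals (\<lambda>s. max (?g s - N) 0) \<le> ennreal (e / 4)"
      using excess[OF fB fr fpos, of N d] n(2)[OF fB] d by (simp add: N_def)
    have "\<forall>\<^sub>F k in sequentially. bmo_seminorm \<S> (\<lambda>x. F k x - f x) \<le> ennreal (d / 4)"
      using conv d unfolding converges_in_BMO_def tendsto_zero_ennreal_iff by auto
    moreover have "\<forall>\<^sub>F k in sequentially.
        bmo_seminorm pos_intervals (\<lambda>s. max (L - ?G k s) 0) \<le> ennreal (e / 4)"
      using low \<open>0 < e\<close> unfolding converges_in_BMO_def tendsto_zero_ennreal_iff by auto
    \<comment> \<open>A uniform bound \<open>e / 8\<close> yields an oscillation of at most
      \<open>e / 4\<close>.\<close>
    moreover have "\<forall>\<^sub>F k in sequentially. \<forall>s>0. \<bar>max L (min N (?G k s)) - max L (min N (?g s))\<bar> \<le> e / 8"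
      using n(1) \<open>0 < e\<close> strict unfolding N_def
      by (intro clamped_decr_rearr_uniform_limit[OF \<Omega> Fr fr Fpos inc lim L0]) auto
    ultimately show ?thesis
    proof eventually_elim
      fix k assume kF: "bmo_seminorm \<S> (\<lambda>x. F k x - f x) \<le> ennreal (d / 4)"
        and k_low: "bmo_seminorm pos_intervals (\<lambda>s. max (L - ?G k s) 0) \<le> ennreal (e / 4)"
        and k_mid: "\<forall>s>0. \<bar>max L (min N (?G k s)) - max L (min N (?g s))\<bar> \<le> e / 8"
      have k_excess: "bmo_seminorm pos_intervals (\<lambda>s. max (?G k s - N) 0) \<le> ennreal (e / 4)"
        using excess[OF FB Fr Fpos, of N d] n(2)[OF FB Fle kF] d by (simp add: N_def)
      show "bmo_seminorm pos_intervals (\<lambda>s. ?G k s - ?g s) \<le> ennreal e"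
      proof (rule bmo_seminorm_le)
        fix I assume I: "I \<in> pos_intervals"
        then have Im: "I \<in> lmeasurable" "0 < measure lebesgue I" and Ipos: "\<And>s. s \<in> I \<Longrightarrow> 0 < s"
          by (auto simp: pos_intervals_def)
        note ints = set_integrable_intros Im int[OF I]
        \<comment> \<open>This is the difference of the two clampings to the range from
          \<open>L\<close> to \<open>N\<close>, written with excesses so that integrability is
          immediate. The rearrangement of \<open>f\<close> needs no lower correction, since it never
          falls below \<open>L\<close>.\<close>
        define mid where "mid s = (?G k s - max (?G k s - N) 0 + max (L - ?G k s) 0)
          - (?g s - max (?g s - N) 0)" for s
        let ?low = "\<lambda>s. max (L - ?G k s) 0" and ?top = "\<lambda>s. max (?G k s - N) 0"
          and ?ftop = "\<lambda>s. max (?g s - N) 0"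
        have mid_int: "set_integrable lebesgue I mid"
          unfolding mid_def by (intro ints)
        have "\<bar>mid s\<bar> \<le> e / 8" if "s \<in> I" for s
        proof -
          have "mid s = max L (min N (?G k s)) - max L (min N (?g s))"
            using Lle[OF Ipos[OF that]] n(1) by (auto simp: mid_def N_def max_def min_def)
          then show ?thesis using k_mid Ipos[OF that] by simp
        qed
        then have 1: "mean_osc mid I \<le> e / 4"
          using mean_osc_le_bound[OF Im mid_int, of "e / 8"] by simp
        have 2: "mean_osc ?low I \<le> e / 4" "mean_osc ?top I \<le> e / 4" "mean_osc ?ftop I \<le> e / 4"
          using mean_osc_le_bmo_seminorm[OF I k_low] mean_osc_le_bmo_seminorm[OF I k_excess]
            mean_osc_le_bmo_seminorm[OF I f_excess] \<open>0 < e\<close> by auto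
        have "mean_osc (\<lambda>s. ?G k s - ?g s) I = mean_osc (\<lambda>s. (mid s - ?low s) - (?ftop s - ?top s)) I"
          by (intro mean_osc_cong) (simp add: mid_def)
        also have "\<dots> \<le> mean_osc (\<lambda>s. mid s - ?low s) I + mean_osc (\<lambda>s. ?ftop s - ?top s) I"
          by (intro mean_osc_diff_le ints mid_int)
        also have "\<dots> \<le> (mean_osc mid I + mean_osc ?low I) + (mean_osc ?ftop I + mean_osc ?top I)"
          by (intro add_mono mean_osc_diff_le ints mid_int)
        finally show "mean_osc (\<lambda>s. ?G k s - ?g s) I \<le> e" using 1 2 by linarith
      qed
    qed
  qed
  then show ?thesis
    using gB GB unfolding converges_in_BMO_def tendsto_zero_ennreal_iff by auto
qed

end
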